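(* Let $\lambda$ be a real number, let $\Lambda=\{\lambda_n\}_{n\ge0}$ be the sequence $\lambda_n=\lambda^n$ for all $n\ge 0$, and let $n\ge 0$ and $m\ge 1$ be integers. Then $(V_n[\Lambda])^m$ is the vertically-recurrent matrix whose associated sequence is $\{(\lambda m)^i\}_{i\ge0}$; that is, $(V_n[\Lambda])^m=V_n[\Lambda^{(m)}]$ with $\Lambda^{(m)}=\{(\lambda m)^i\}_{i\ge 0}$ (where $x^0=1$ for all $x$).
   Context: Rows and columns of matrices are indexed from $0$. Given a sequence $\Lambda=\{\lambda_n\}_{n\ge0}$ of real numbers with $\lambda_0=1$, define numbers $a_{i,j}$ ($i,j\ge 0$) by $a_{i,0}=\lambda_i$ for $i\ge 0$, $a_{i,j}=0$ for $i<j$, and $$a_{i,j}=\sum_{l=j-1}^{i-1}\lambda_{i-1-l}\,a_{l,j-1}\qquad (i\ge j\ge 1).$$ The vertically-recurrent matrix with associated sequence $\Lambda$, of order $(n+1)\times(n+1)$, is $V_n[\Lambda]=[a_{i,j}]_{0\le i,j\le n}$. *)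

theory Defs
  imports Complex_Main "Jordan_Normal_Form.Matrix"
begin

text \<open>The associated sequences are real sequences starting with 1. The recursion below
  makes sense for any sequence, so this normalisation is not built into the definitions.\<close>

fun vr_entry :: "(nat \<Rightarrow> real) \<Rightarrow> nat \<Rightarrow> nat \<Rightarrow> real" where
  "vr_entry \<Lambda> i 0 = \<Lambda> i"
| "vr_entry \<Lambda> i (Suc j) =
     (if i < Suc j then 0 else (\<Sum>l = j..i - 1. \<Lambda> (i - 1 - l) * vr_entry \<Lambda> l j))"

text \<open>The index \<open>n\<close> is that of the last row and column: the matrix has order
  \<open>(n + 1) \<times> (n + 1)\<close>.\<close>

definition vr_matrix :: "nat \<Rightarrow> (nat \<Rightarrow> real) \<Rightarrow> real mat" where
  "vr_matrix n \<Lambda> = mat (n + 1) (n + 1) (\<lambda>(i, j). vr_entry \<Lambda> i j)"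

end

theory Submission
  imports Defs
begin

text \<open>For the sequence of powers of \<open>c\<close> the matrix is the generalised Pascal matrix with
  entries \<open>(i choose j) * c ^ (i - j)\<close>. By the binomial theorem the parameters \<open>c\<close> add up under
  multiplication of such matrices, so the power \<open>m\<close> has parameter \<open>c * m\<close>.\<close>

lemma vr_entry_power:
  "vr_entry (\<lambda>k. c ^ k) i j = real (i choose j) * c ^ (i - j)"
proof (induction j arbitrary: i)
  case 0
  show ?case by simp
next
  case (Suc j)
  show ?case
  proof (cases "i < Suc j")
    case True
    then show ?thesis by simp
  next
    case False
    then obtain p where i: "i = Suc p" and p: "j \<le> p"
      by (cases i) auto
    have "vr_entry (\<lambda>k. c ^ k) i (Suc j) =
        (\<Sum>l = j..p. c ^ (p - l) * (real (l choose j) * c ^ (l - j)))"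
      using p by (simp add: i Suc.IH)
    \<comment> \<open>The two powers combine to one that does not depend on \<open>l\<close>, so
      only a sum of binomial coefficients down a column remains.\<close>
    also have "\<dots> = (\<Sum>l = j..p. c ^ (p - j) * real (l choose j))"
      by (intro sum.cong refl) (simp flip: power_add)
    also have "\<dots> = c ^ (p - j) * (\<Sum>l = j..p. real (l choose j))"
      by (simp add: sum_distrib_left)
    \<comment> \<open>Terms with \<open>l < j\<close> vanish; starting at 0 gives the form of the
      hockey-stick identity.\<close>
    also have "(\<Sum>l = j..p. real (l choose j)) = (\<Sum>l = 0..p. real (l choose j))"
      by (rule sum.mono_neutral_left) auto
    also have "\<dots> = real (i choose Suc j)"
      by (simp add: i atLeast0AtMost sum_choose_upper flip: of_nat_sum)
    finally show ?thesis
      by (simp add: i)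
  qed
qed

text \<open>The left side is an entry of the product of two generalised Pascal matrices. Trinomial
  revision pulls \<open>i choose j\<close> out of each term, and the rest is a binomial
  expansion.\<close>

lemma sum_choose_choose_powers:
  fixes a b :: real
  assumes "i \<le> n"
  shows "(\<Sum>k = 0..<Suc n. real (i choose k) * a ^ (i - k) * (real (k choose j) * b ^ (k - j))) =
    real (i choose j) * (a + b) ^ (i - j)"
    (is "(\<Sum>k = _..<_. ?f k) = _")
proof (cases "j \<le> i")
  case False
  then have "?f k = 0" for k
    by (cases "k \<le> i") auto
  then have "(\<Sum>k = 0..<Suc n. ?f k) = 0"
    by (intro sum.neutral ballI)
  with False show ?thesis by simp
next
  case True
  \<comment> \<open>Outside \<open>j..i\<close> one of the two coefficients is zero, and
    \<open>i \<le> n\<close> keeps this interval inside the summation range.\<close>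
  have "(\<Sum>k = 0..<Suc n. ?f k) = (\<Sum>k = j..i. ?f k)"
    using assms by (intro sum.mono_neutral_right) auto
  also have "\<dots> = (\<Sum>k = 0..i - j. ?f (k + j))"
    using True sum.shift_bounds_cl_nat_ivl[of ?f 0 j "i - j"] by simp
  also have "\<dots> = (\<Sum>k = 0..i - j.
      real (i choose j) * (real ((i - j) choose k) * b ^ k * a ^ (i - j - k)))"
  proof (intro sum.cong refl)
    fix k assume k: "k \<in> {0..i - j}"
    have "(i choose (k + j)) * ((k + j) choose j) = (i choose j) * ((i - j) choose k)"
      using choose_mult[of j "k + j" i] k True by simp
    then have "real (i choose (k + j)) * real ((k + j) choose j) =
        real (i choose j) * real ((i - j) choose k)"
      by (metis of_nat_mult)
    then show "?f (k + j) = real (i choose j) * (real ((i - j) choose k) * b ^ k * a ^ (i - j - k))"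
      by (simp add: add.commute mult.assoc mult.left_commute)
  qed
  also have "\<dots> = real (i choose j) * (b + a) ^ (i - j)"
    by (simp add: binomial_ring sum_distrib_left atLeast0AtMost)
  finally show ?thesis
    by (simp add: add.commute)
qed

lemma vr_matrix_power_mult:
  "vr_matrix n (\<lambda>k. a ^ k) * vr_matrix n (\<lambda>k. b ^ k) = vr_matrix n (\<lambda>k. (a + b) ^ k)"
  \<comment> \<open>Splitting off the last summand would hide the sum from
    \<open>sum_choose_choose_powers\<close>.\<close>
  by (rule eq_matI)
    (simp_all add: vr_matrix_def scalar_prod_def vr_entry_power sum_choose_choose_powers
      del: sum.op_ivl_Suc)

lemma vr_matrix_power_zero: "vr_matrix n (\<lambda>k. 0 ^ k) = 1\<^sub>m (n + 1)"
  proof -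
  \<comment> \<open>Above the diagonal the coefficient is zero, below it the power is; on it
    \<open>0 ^ 0 = 1\<close>.\<close>
  have "real (i choose j) * 0 ^ (i - j) = (if i = j then 1 else 0)" for i j
    by (cases i j rule: linorder_cases) auto
  then show ?thesis
    by (intro eq_matI) (simp_all only: vr_matrix_def vr_entry_power index_mat one_mat_def
      dim_row_mat dim_col_mat prod.case)
qed

theorem theorem3p3:
  fixes c :: real and \<Lambda> :: "nat \<Rightarrow> real" and n m :: nat
  assumes "\<And>k. \<Lambda> k = c ^ k" and "m \<ge> 1"
  shows "vr_matrix n \<Lambda> ^\<^sub>m m = vr_matrix n (\<lambda>i. (c * real m) ^ i)"
proof -
  have \<Lambda>: "\<Lambda> = (\<lambda>k. c ^ k)"
    using assms(1) by blast
  show ?thesis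
  proof (induction m)
    case 0
    \<comment> \<open>The zeroth power is the identity matrix of size \<open>dim_row\<close>, which
      is the matrix with parameter \<open>c * 0 = 0\<close>.\<close>
    have "dim_row (vr_matrix n \<Lambda>) = n + 1"
      by (simp add: vr_matrix_def)
    then show ?case
      using vr_matrix_power_zero[of n] by simp
  next
    case (Suc m)
    have "c * real m + c = c * real (Suc m)"
      by (simp add: algebra_simps)
    with Suc show ?case
      by (simp only: pow_mat.simps \<Lambda> vr_matrix_power_mult)
  qed
qed

end
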